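(* Let $ABC$ be an acute triangle with side lengths $a=|BC|$, $b=|AC|$, $c=|AB|$ satisfying $a<b<c$, and let $T'$ be a minimum area isosceles container for $ABC$. Then $T'$ is obtuse if and only if $T'$ is a special container of the second kind associated with $ABC$.
   Context: Triangles are non-degenerate closed triangular regions in the plane. A triangle is acute if all its angles are less than $90^\circ$, and obtuse if one of its angles is greater than $90^\circ$. An isosceles triangle is one with at least two sides of equal length. An isosceles container for a triangle $T$ is an isosceles triangle $T'$ with $T\subseteq T'$; it is a minimum area isosceles container if its area is at most that of every isosceles container for $T$. $\vec{XY}$ denotes the ray starting at $X$ and passing through $Y$. Let $ABC$ be a triangle with $a=|BC|<b=|AC|<c=|AB|$. Special containers of the second kind associated with $ABC$: the isosceles triangles $AB_1C$, $ABC_1$, $ABC_2$, where $B_1\ne A$ is the point on the ray $\vec{AB}$ with $|B_1C|=|AC|=b$; $C_1\neq A$ is the point on the ray $\vec{AC}$ with $|BC_1|=|AB|=c$; $C_2\ne B$ is the point on the ray $\vec{BC}$ with $|AC_2|=|AB|=c$. *)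

theory Defs
  imports "HOL-Analysis.Analysis"
begin

type_synonym point = "real ^ 2"

text \<open>The unoriented angle at the middle argument \<open>Q\<close>, in radians.  It is only meaningful if
  \<open>P\<close> and \<open>R\<close> differ from \<open>Q\<close>.\<close>

definition angle :: "point \<Rightarrow> point \<Rightarrow> point \<Rightarrow> real" where
  "angle P Q R = arccos (((P - Q) \<bullet> (R - Q)) / (norm (P - Q) * norm (R - Q)))"

definition ray :: "point \<Rightarrow> point \<Rightarrow> point set" where
  "ray X Y = {X + t *\<^sub>R (Y - X) | t. t \<ge> 0}"

text \<open>Triangles are closed regions, so a triangle is a set of points.  The set determines the
  three vertices (its extreme points) up to their order, hence the existential quantifiers over
  vertices in the predicates below do not leave any choice beyond a relabelling.\<close>

definition triangle_with_vertices :: "point \<Rightarrow> point \<Rightarrow> point \<Rightarrow> point set \<Rightarrow> bool" where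
  "triangle_with_vertices P Q R T \<longleftrightarrow> \<not> collinear {P, Q, R} \<and> T = convex hull {P, Q, R}"

definition acute_triangle :: "point set \<Rightarrow> bool" where
  "acute_triangle T \<longleftrightarrow> (\<exists>P Q R. triangle_with_vertices P Q R T \<and>
     angle Q P R < pi / 2 \<and> angle P Q R < pi / 2 \<and> angle P R Q < pi / 2)"

definition obtuse_triangle :: "point set \<Rightarrow> bool" where
  "obtuse_triangle T \<longleftrightarrow> (\<exists>P Q R. triangle_with_vertices P Q R T \<and>
     (angle Q P R > pi / 2 \<or> angle P Q R > pi / 2 \<or> angle P R Q > pi / 2))"

definition isosceles_triangle :: "point set \<Rightarrow> bool" where
  "isosceles_triangle T \<longleftrightarrow> (\<exists>P Q R. triangle_with_vertices P Q R T \<and>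
     (dist P Q = dist P R \<or> dist Q P = dist Q R \<or> dist R P = dist R Q))"

definition isosceles_container :: "point set \<Rightarrow> point set \<Rightarrow> bool" where
  "isosceles_container T T' \<longleftrightarrow> isosceles_triangle T' \<and> T \<subseteq> T'"

definition min_area_isosceles_container :: "point set \<Rightarrow> point set \<Rightarrow> bool" where
  "min_area_isosceles_container T T' \<longleftrightarrow> isosceles_container T T' \<and>
     (\<forall>T''. isosceles_container T T'' \<longrightarrow> measure lebesgue T' \<le> measure lebesgue T'')"

text \<open>The points \<open>B1\<close>, \<open>C1\<close>, \<open>C2\<close> are unique where they exist: a ray that starts at a point of a
  circle meets the circle in at most one further point.\<close>

definition special_container_second_kind ::
    "point \<Rightarrow> point \<Rightarrow> point \<Rightarrow> point set \<Rightarrow> bool" where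
  "special_container_second_kind A B C T \<longleftrightarrow>
     (\<exists>B1. B1 \<in> ray A B \<and> B1 \<noteq> A \<and> dist B1 C = dist A C \<and> triangle_with_vertices A B1 C T) \<or>
     (\<exists>C1. C1 \<in> ray A C \<and> C1 \<noteq> A \<and> dist B C1 = dist A B \<and> triangle_with_vertices A B C1 T) \<or>
     (\<exists>C2. C2 \<in> ray B C \<and> C2 \<noteq> B \<and> dist A C2 = dist A B \<and> triangle_with_vertices A B C2 T)"

end

theory Submission
  imports Defs
begin

text \<open>Write \<open>K\<close> for twice the area of \<open>ABC\<close>.  Comparing with the containers obtained by stretching one
  side to the length of another (area factors \<open>c/b\<close> and \<open>b/a\<close>) excludes \<open>ABC\<^sub>1\<close> and \<open>ABC\<^sub>2\<close> as
  minimizers, and shows that \<open>AB\<^sub>1C\<close> can only be minimal if its apex angle is obtuse.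

  Conversely, put an obtuse minimizer in the position with base corners \<open>(\<plusminus>L, 0)\<close> and apex
  \<open>(0, h)\<close>, \<open>h < L\<close>.  If vertices \<open>p\<close>, \<open>q\<close> lie under the right and left leg, then with \<open>X = x p - x q\<close>
  and \<open>Y = y p + y q\<close> one has \<open>Y L + X h \<le> 2 h L\<close>, hence \<open>X Y \<le> h L\<close> whenever \<open>X, Y \<ge> 0\<close>.  The
  right isosceles container in the same position, whose area is \<open>(X + Y)\<^sup>2 / 4\<close> for the extreme
  pair, is not smaller, which forces \<open>Y < X\<close>: the vertices are so flat that some angle of \<open>ABC\<close> is
  at most \<open>\<pi>/4\<close>, so it is the angle at \<open>A\<close>.  Then \<open>X Y\<close> is at least the area of \<open>AB\<^sub>1C\<close>, and the
  equality case is rigid.\<close>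

section \<open>Inequalities for a pair of vertices below the legs\<close>

text \<open>AM-GM for \<open>Y * L\<close> and \<open>X * h\<close>: their sum is at most
  \<open>2 * (h * L)\<close> and their product at least the square of \<open>h * L\<close>, so both
  equal \<open>h * L\<close>.\<close>

lemma pair_rigid:
  fixes h L X Y :: real
  assumes "0 < h" "0 < L" "0 \<le> X" "0 \<le> Y" "Y * L + X * h \<le> 2 * (h * L)" "h * L \<le> X * Y"
  shows "X = L" "Y = h"
proof -
  have "(Y * L + X * h)\<^sup>2 \<le> (2 * (h * L))\<^sup>2"
    using assms by (intro power_mono) auto
  moreover have "(h * L) * (h * L) \<le> (X * Y) * (h * L)"
    using assms by (intro mult_right_mono) auto
  moreover have "(Y * L - X * h)\<^sup>2 = (Y * L + X * h)\<^sup>2 - 4 * ((X * Y) * (h * L))"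
    by (simp add: power2_eq_square algebra_simps)
  moreover have "(2 * (h * L))\<^sup>2 = 4 * ((h * L) * (h * L))"
    by (simp add: power2_eq_square algebra_simps)
  ultimately have "(Y * L - X * h)\<^sup>2 \<le> 0" by linarith
  then have e: "Y * L = X * h" by simp
  with assms have "Y * L \<le> h * L" "X * h \<le> L * h" by (auto simp: mult.commute)
  then have le: "Y \<le> h" "X \<le> L" using assms by auto
  have "X * Y \<le> L * Y" using le assms by (intro mult_right_mono) auto
  with assms(6) have "h * L \<le> Y * L" by (simp add: mult.commute)
  then show "Y = h" using le assms by auto
  have "X * Y \<le> X * h" using le assms by (intro mult_left_mono) auto
  with assms(6) have "L * h \<le> X * h" by (simp add: mult.commute)
  then show "X = L" using le assms by auto
qed

text \<open>Let phi be the direction of w and theta the angle between u and w. Then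
  \<open>bound\<close> reads h L \<le> |w|^2 sin(2 theta) / 2, while \<open>w1 * w2\<close> is |w|^2
  sin(2 phi) / 2. As theta \<le> phi \<le> pi/4, \<open>pair_rigid\<close> applies to w.\<close>

lemma sector_rigid:
  fixes h L u1 u2 w1 w2 :: real
  assumes "0 < h" "0 < L" "0 \<le> u2" "0 \<le> w2" "u2 \<le> u1" "w2 \<le> w1"
    and cross: "0 < u1 * w2 - u2 * w1"
    and pair: "w2 * L + w1 * h \<le> 2 * (h * L)"
    and bound: "h * L * (u1\<^sup>2 + u2\<^sup>2) \<le> (u1 * w2 - u2 * w1) * (u1 * w1 + u2 * w2)"
  shows "u2 = 0" "w1 = L" "w2 = h"
proof -
  have u1: "u1 > 0"
    using assms by (cases "u1 = 0") auto
  \<comment> \<open>The algebraic form of sin(2 theta) \<le> sin(2 phi): in the sector both extra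
    terms are nonnegative.\<close>
  have id: "(w1 * w2) * (u1\<^sup>2 + u2\<^sup>2) = (u1 * w2 - u2 * w1) * (u1 * w1 + u2 * w2)
     + 2 * u2\<^sup>2 * (w1 * w2) + u1 * u2 * ((w1 - w2) * (w1 + w2))"
    by (simp add: power2_eq_square algebra_simps)
  have n1: "0 \<le> 2 * u2\<^sup>2 * (w1 * w2)" and n2: "0 \<le> u1 * u2 * ((w1 - w2) * (w1 + w2))"
    using assms by auto
  have pos: "0 < u1\<^sup>2 + u2\<^sup>2" using u1 by (simp add: add_pos_nonneg)
  have "(h * L) * (u1\<^sup>2 + u2\<^sup>2) \<le> (w1 * w2) * (u1\<^sup>2 + u2\<^sup>2)"
    using id n1 n2 bound by linarith
  then have "h * L \<le> w1 * w2" using pos by simp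
  then show e: "w1 = L" "w2 = h"
    using pair_rigid[of h L w1 w2] assms by auto
  have "2 * u2\<^sup>2 * (w1 * w2) \<le> 0"
    using id n2 bound unfolding e by (simp add: mult.commute)
  then show "u2 = 0" unfolding e using assms
    by (simp add: mult_le_0_iff zero_less_mult_iff)
qed

text \<open>Squaring the leg constraint and inserting the area bound leaves a difference that
  factors as \<open>(Y\<^sup>2 * L - X\<^sup>2 * h) * (L - h)\<close>.\<close>

lemma right_shape_compare:
  fixes h L X Y :: real
  assumes "0 < h" "h < L" "0 \<le> Y" "0 \<le> X + Y"
    and "Y * L + X * h \<le> 2 * (h * L)" "h * L \<le> (X + Y)\<^sup>2 / 4"
  shows "Y\<^sup>2 * L \<le> X\<^sup>2 * h"
proof -
  have "0 \<le> Y * (L - h) + (X + Y) * h" using assms by auto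
  then have "0 \<le> Y * L + X * h" by (simp add: algebra_simps)
  then have "(Y * L + X * h)\<^sup>2 \<le> (2 * (h * L))\<^sup>2" using assms by (intro power_mono) auto
  also have "\<dots> = 4 * (h * L) * (h * L)" by (simp add: power2_eq_square)
  also have "\<dots> \<le> (X + Y)\<^sup>2 * (h * L)" using assms by (intro mult_right_mono) auto
  finally have "(Y\<^sup>2 * L - X\<^sup>2 * h) * (L - h) \<le> 0"
    by (simp add: power2_eq_square algebra_simps)
  then show ?thesis using assms by (simp add: mult_le_0_iff)
qed

text \<open>Here \<open>v\<close> is the origin and \<open>u\<close>, \<open>w\<close> touch the right and left leg: the conclusion says that the
  angle at \<open>u\<close> is at most \<open>\<pi>/4\<close>.\<close>

lemma flat_pair_angle:
  fixes u1 u2 w1 w2 :: real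
  assumes "0 \<le> u2" "0 \<le> w2" "u2 < u1" "u2 + w2 < u1 - w1" "0 < u1 * w1 + u2 * w2"
  shows "u1 * w2 - u2 * w1 \<le> u1 * (u1 - w1) + u2 * (u2 - w2)"
proof -
  \<comment> \<open>The goal is \<open>u1 * (w1 + w2) \<le> u1 * (u1 - u2)\<close> plus
    \<open>u2\<close> times this claim. If \<open>- w1\<close> exceeded \<open>u2\<close>, the acute
    angle at the origin would force \<open>u1 < w2\<close>, which is incompatible with the flatness
    hypothesis.\<close>
  have main: "u2 \<noteq> 0 \<Longrightarrow> w2 - w1 \<le> u1 + u2"
  proof (cases "- w1 \<le> u2")
    case False
    assume "u2 \<noteq> 0"
    have "u1 * u2 < u1 * (- w1)" using assms False by (intro mult_strict_left_mono) auto
    then have "u1 * u2 < u2 * w2" using assms by simp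
    then have "u2 * u1 < u2 * w2" by (simp only: mult.commute)
    then have "u1 < w2" using assms \<open>u2 \<noteq> 0\<close> by simp
    have "u1 * (- w1) < u2 * w2" using assms by simp
    moreover have "w2 * (u1 - u2) \<ge> u1 * (u1 - u2)"
      using \<open>u1 < w2\<close> assms by (intro mult_right_mono) auto
    moreover have "u1 * (u2 + w2) < u1 * (u1 - w1)"
      using assms by (intro mult_strict_left_mono) auto
    ultimately show ?thesis by (simp add: algebra_simps)
  qed (use assms in auto)
  have "u1 * (w1 + w2) \<le> u1 * (u1 - u2)"
    using assms by (intro mult_left_mono) auto
  moreover have "u2 * (w2 - w1) \<le> u2 * (u1 + u2)"
    using assms main by (cases "u2 = 0") (auto intro: mult_left_mono)
  ultimately show ?thesis by (simp add: algebra_simps)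
qed

text \<open>If w were lower than u, the bound for the side from u to w would give
  \<open>h * L < u1 * u2\<close>, against \<open>pair_rigid\<close> for u. Otherwise the two bounds
  together give \<open>h * L \<le> (u1 - w1) * w2\<close>, and \<open>pair_rigid\<close> for
  \<open>u1 - w1\<close> and \<open>u2 + w2\<close> leaves no room for a positive
  \<open>u2\<close>.\<close>

lemma flat_pair_rigid:
  fixes h L u1 u2 w1 w2 :: real
  assumes "0 < h" "0 < L" "0 \<le> u2" "0 \<le> w2" "u2 < u1" "w1 < u1"
    and pair: "(u2 + w2) * L + (u1 - w1) * h \<le> 2 * (h * L)" "u2 * L + u1 * h \<le> 2 * (h * L)"
    and bound: "h * L * (u1\<^sup>2 + u2\<^sup>2) \<le> (u1 * w2 - u2 * w1) * (u1 * (u1 - w1) + u2 * (u2 - w2))"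
      "h * L * ((u1 - w1)\<^sup>2 + (u2 - w2)\<^sup>2)
         \<le> (u1 * w2 - u2 * w1) * (u1 * (u1 - w1) + u2 * (u2 - w2))"
  shows "u2 = 0" "u1 - w1 = L" "w2 = h"
proof -
  define d e where "d = u1 - w1" and "e = w2 - u2"
  have d: "d > 0" using assms d_def by simp
  have w: "w1 = u1 - d" "w2 = u2 + e" by (auto simp: d_def e_def)
  have KD: "(u1 * w2 - u2 * w1) * (u1 * (u1 - w1) + u2 * (u2 - w2))
      = u1 * u2 * d\<^sup>2 + (u1\<^sup>2 - u2\<^sup>2) * (d * e) - u1 * u2 * e\<^sup>2"
    unfolding w by (simp add: power2_eq_square algebra_simps)
  have e0: "e \<ge> 0"
  proof (rule ccontr)
    assume "\<not> e \<ge> 0"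
    then have u2: "u2 > 0" using assms(4) w by auto
    have diff: "0 < (u1 * u2) * (2 * e\<^sup>2)" using u2 assms \<open>\<not> e \<ge> 0\<close> by auto
    have "u2\<^sup>2 \<le> u1\<^sup>2" using assms by (intro power_mono) auto
    then have "(u1\<^sup>2 - u2\<^sup>2) * (d * e) \<le> 0" using d \<open>\<not> e \<ge> 0\<close>
      by (simp add: mult_le_0_iff)
    moreover have "h * L * (d\<^sup>2 + e\<^sup>2) \<le> u1 * u2 * d\<^sup>2 + (u1\<^sup>2 - u2\<^sup>2) * (d * e) - u1 * u2 * e\<^sup>2"
      using bound(2) unfolding KD by (simp add: d_def e_def power2_commute)
    ultimately have lt: "(h * L) * (d\<^sup>2 + e\<^sup>2) < (u1 * u2) * (d\<^sup>2 + e\<^sup>2)"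
      using diff by (simp add: algebra_simps)
    then have "h * L \<le> u1 * u2"
      by (meson add_nonneg_nonneg less_imp_le mult_less_cancel_right not_le zero_le_power2)
    then have "u1 = L" "u2 = h"
      using pair_rigid[of h L u1 u2] assms by auto
    then show False using lt by (simp add: mult.commute)
  qed
  \<comment> \<open>The larger squared side at u dominates \<open>u1\<^sup>2\<close> and
    \<open>d\<^sup>2\<close>, hence \<open>u1 * d\<close>. So the first two terms in
    \<open>b\<close> are at most \<open>m * d * u2\<close> and \<open>m * d * e\<close>, and the
    third is not positive.\<close>
  define m where "m = max (u1\<^sup>2 + u2\<^sup>2) (d\<^sup>2 + e\<^sup>2)"
  have b: "h * L * m \<le> u1 * u2 * d\<^sup>2 + (u1\<^sup>2 - u2\<^sup>2) * (d * e) - u1 * u2 * e\<^sup>2"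
    using bound unfolding KD m_def by (auto simp: max_def d_def e_def power2_commute)
  have m: "u1\<^sup>2 \<le> m" "d\<^sup>2 \<le> m" unfolding m_def by (auto simp: le_max_iff_disj)
  have mpos: "m > 0" using m(2) d by (meson less_le_trans zero_less_power)
  have "2 * (u1 * d) \<le> u1\<^sup>2 + d\<^sup>2"
    using zero_le_power2[of "u1 - d"] by (simp add: power2_eq_square algebra_simps)
  then have "u1 * d \<le> m" using m by linarith
  then have t1: "(u2 * d) * (u1 * d) \<le> (u2 * d) * m"
    using assms d by (intro mult_left_mono) auto
  have t2: "(u1\<^sup>2 - u2\<^sup>2) * (d * e) \<le> m * (d * e)"
    using m d e0 by (intro mult_right_mono) (auto intro: order_trans[of _ "u1\<^sup>2"])
  have t3: "u1 * u2 * e\<^sup>2 \<ge> 0" using assms by auto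
  have up: "h * L * m \<le> d * (u2 + e) * m"
    using b t1 t2 t3 by (simp add: power2_eq_square algebra_simps)
  then have up': "h * L \<le> d * (u2 + e)" using mpos by simp
  also have "\<dots> \<le> d * (u2 + w2)" using d assms w by (intro mult_left_mono) auto
  finally have r: "d = L" "u2 + w2 = h"
    using pair_rigid[of h L d "u2 + w2"] assms d d_def by auto
  have "u2 + e = h - u2" using r w by simp
  then have "h * L \<le> (h - u2) * L" using up' unfolding r(1) by (simp only: mult.commute)
  then have "h \<le> h - u2" using \<open>0 < L\<close> by (rule mult_right_le_imp_le)
  then show "u2 = 0" using \<open>0 \<le> u2\<close> by simp
  then show "w2 = h" using r by simp
  show "u1 - w1 = L" using r d_def by simp
qed

section \<open>Position of the vertices in a minimal obtuse container\<close>

text \<open>The coordinates \<open>x\<close>, \<open>y\<close> are parameters, so that a reflection in the axis of the container is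
  the passage from \<open>x\<close> to \<open>\<lambda>z. - x z\<close>.\<close>

definition sdot :: "('v \<Rightarrow> real) \<Rightarrow> ('v \<Rightarrow> real) \<Rightarrow> 'v \<Rightarrow> 'v \<Rightarrow> 'v \<Rightarrow> real" where
  "sdot x y v u w = (x u - x v) * (x w - x v) + (y u - y v) * (y w - y v)"

definition scross :: "('v \<Rightarrow> real) \<Rightarrow> ('v \<Rightarrow> real) \<Rightarrow> 'v \<Rightarrow> 'v \<Rightarrow> 'v \<Rightarrow> real" where
  "scross x y v u w = (x u - x v) * (y w - y v) - (y u - y v) * (x w - x v)"

text \<open>Membership in the closed triangle with base corners \<open>(- L, 0)\<close>,
  \<open>(L, 0)\<close> and apex \<open>(0, h)\<close>.\<close>

definition fits :: "('v \<Rightarrow> real) \<Rightarrow> ('v \<Rightarrow> real) \<Rightarrow> real \<Rightarrow> real \<Rightarrow> 'v \<Rightarrow> bool" where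
  "fits x y h L v \<longleftrightarrow> 0 \<le> y v \<and> y v * L + \<bar>x v\<bar> * h \<le> h * L"

text \<open>For the corner \<open>A\<close> this is the comparison with the areas of \<open>AB\<^sub>1C\<close> and \<open>ABC\<^sub>1\<close>; for the
  corners \<open>B\<close> and \<open>C\<close> the premise fails.\<close>

definition corner_bound :: "('v \<Rightarrow> real) \<Rightarrow> ('v \<Rightarrow> real) \<Rightarrow> real \<Rightarrow> real \<Rightarrow> 'v \<Rightarrow> 'v \<Rightarrow> 'v \<Rightarrow> bool"
  where "corner_bound x y h L v u w \<longleftrightarrow> (\<bar>scross x y v u w\<bar> \<le> sdot x y v u w \<longrightarrow>
     (\<forall>z\<in>{u, w}. h * L * ((x z - x v)\<^sup>2 + (y z - y v)\<^sup>2)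
        \<le> \<bar>scross x y v u w\<bar> * sdot x y v u w))"

text \<open>The lines \<open>y = m\<close>, \<open>x + y = r\<close>, \<open>y - x = s\<close> bound a right isosceles triangle of area
  \<open>(r + s - 2 m)\<^sup>2 / 4\<close>.\<close>

definition right_bound :: "('v \<Rightarrow> real) \<Rightarrow> ('v \<Rightarrow> real) \<Rightarrow> real \<Rightarrow> real \<Rightarrow> 'v set \<Rightarrow> bool"
  where "right_bound x y h L V \<longleftrightarrow>
     (\<forall>m r s. (\<forall>z\<in>V. m \<le> y z \<and> x z + y z \<le> r \<and> y z - x z \<le> s)
        \<longrightarrow> h * L \<le> (r + s - 2 * m)\<^sup>2 / 4)"

text \<open>What is retained of an acute triangle in a minimal obtuse container. The order of the
  sides is forgotten, so the condition is invariant under relabelling and reflection.\<close>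

definition tight :: "('v \<Rightarrow> real) \<Rightarrow> ('v \<Rightarrow> real) \<Rightarrow> real \<Rightarrow> real \<Rightarrow> 'v \<Rightarrow> 'v \<Rightarrow> 'v \<Rightarrow> bool" where
  "tight x y h L v u w \<longleftrightarrow> 0 < h \<and> h < L \<and> (\<forall>z\<in>{v, u, w}. fits x y h L z) \<and>
     0 < sdot x y v u w \<and> 0 < sdot x y u v w \<and> 0 < sdot x y w v u \<and> scross x y v u w \<noteq> 0 \<and>
     corner_bound x y h L v u w \<and> corner_bound x y h L u v w \<and> corner_bound x y h L w v u \<and>
     right_bound x y h L {v, u, w}"

text \<open>The position of \<open>v = A\<close>, \<open>u = B\<close>, \<open>w = C\<close> in the
  container \<open>AB1C\<close>: a base corner, a point of the base line, the apex.\<close>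

definition extremal :: "('v \<Rightarrow> real) \<Rightarrow> ('v \<Rightarrow> real) \<Rightarrow> real \<Rightarrow> real \<Rightarrow> 'v \<Rightarrow> 'v \<Rightarrow> 'v \<Rightarrow> bool" where
  "extremal x y h L v u w \<longleftrightarrow>
     \<bar>x v\<bar> = L \<and> y v = 0 \<and> x w = 0 \<and> y w = h \<and> y u = 0"

section \<open>Relabelling of the vertices and reflection in the axis\<close>

lemma sdot_swap: "sdot x y v w u = sdot x y v u w"
  by (simp add: sdot_def mult.commute)

lemma scross_swap: "scross x y v w u = - scross x y v u w"
  and scross_rot: "scross x y u v w = - scross x y v u w"
  by (auto simp: scross_def algebra_simps)

lemma corner_bound_swap: "corner_bound x y h L v w u \<longleftrightarrow> corner_bound x y h L v u w"
  unfolding corner_bound_def by (simp add: sdot_swap[of x y v w u] scross_swap[of x y v w u] conj_commute)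

lemma tight_swap: "tight x y h L v u w \<Longrightarrow> tight x y h L v w u"
  unfolding tight_def
  by (simp add: sdot_swap[of x y v w u] sdot_swap[of x y w u v] sdot_swap[of x y u w v]
      scross_swap[of x y v w u] corner_bound_swap[of x y h L v w u]
      corner_bound_swap[of x y h L w u v] corner_bound_swap[of x y h L u w v] insert_commute)

text \<open>This transposition and \<open>tight_swap\<close> generate all relabellings, so any
  vertex can be put first.\<close>

lemma tight_rot: "tight x y h L v u w \<Longrightarrow> tight x y h L u v w"
  unfolding tight_def
  by (simp add: sdot_swap[of x y w u v] scross_rot[of x y u v w]
      corner_bound_swap[of x y h L w u v] insert_commute)

lemma mirror_simps:
  "sdot (\<lambda>z. - x z) y v u w = sdot x y v u w"
  "scross (\<lambda>z. - x z) y v u w = - scross x y v u w"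
  "fits (\<lambda>z. - x z) y h L v = fits x y h L v"
  "extremal (\<lambda>z. - x z) y h L v u w = extremal x y h L v u w"
  by (auto simp: sdot_def scross_def fits_def extremal_def algebra_simps)

lemma corner_bound_mirror: "corner_bound (\<lambda>z. - x z) y h L v u w = corner_bound x y h L v u w"
proof -
  have "(- x z + x v)\<^sup>2 = (x z - x v)\<^sup>2" for z
    by (simp add: power2_commute)
  then show ?thesis by (simp add: corner_bound_def mirror_simps)
qed

lemma right_bound_mirror:
  assumes "right_bound x y h L V" shows "right_bound (\<lambda>z. - x z) y h L V"
  unfolding right_bound_def
proof (intro allI impI)
  fix m r s assume "\<forall>z\<in>V. m \<le> y z \<and> - x z + y z \<le> r \<and> y z - - x z \<le> s"
  \<comment> \<open>The reflection exchanges the lines of slope -1 and 1, hence \<open>r\<close> and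
    \<open>s\<close>.\<close>
  then have "\<forall>z\<in>V. m \<le> y z \<and> x z + y z \<le> s \<and> y z - x z \<le> r" by (auto simp: algebra_simps)
  with assms show "h * L \<le> (r + s - 2 * m)\<^sup>2 / 4"
    unfolding right_bound_def by (metis add.commute)
qed

lemma tight_mirror: "tight x y h L v u w \<Longrightarrow> tight (\<lambda>z. - x z) y h L v u w"
  unfolding tight_def by (simp add: mirror_simps corner_bound_mirror right_bound_mirror)

text \<open>The sum of the constraint of the right leg on \<open>p\<close> and that of the left leg
  on \<open>q\<close>.\<close>

lemma fits_pair:
  assumes "fits x y h L p" "fits x y h L q" "0 < h" "0 < L"
  shows "(y p + y q) * L + (x p - x q) * h \<le> 2 * (h * L)"
proof -
  have "x p * h \<le> \<bar>x p\<bar> * h" "- x q * h \<le> \<bar>x q\<bar> * h"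
    using assms by (intro mult_right_mono; simp)+
  moreover have "y p * L + \<bar>x p\<bar> * h \<le> h * L" "y q * L + \<bar>x q\<bar> * h \<le> h * L"
    using assms by (auto simp: fits_def)
  ultimately show ?thesis unfolding distrib_right left_diff_distrib by linarith
qed

text \<open>Used with \<open>m = 2 * y v\<close> to measure both heights from the lowest
  vertex.\<close>

lemma fits_pair_shift:
  assumes "fits x y h L p" "fits x y h L q" "0 < h" "0 < L" "0 \<le> m"
  shows "(y p + y q - m) * L + (x p - x q) * h \<le> 2 * (h * L)"
proof -
  have "0 \<le> m * L" using assms by simp
  then show ?thesis using fits_pair[OF assms(1-4)] by (simp add: algebra_simps)
qed

text \<open>A height difference \<open>h\<close> is the full height of the container:
  \<open>w\<close> must be the apex and \<open>v\<close> must lie on the base line.\<close>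

lemma extremalI:
  assumes "fits x y h L v" "fits x y h L w" "0 < h" "0 < L"
    and "\<bar>x w - x v\<bar> = L" "y w - y v = h" "y u = y v"
  shows "extremal x y h L v u w"
proof -
  have v: "0 \<le> y v" "y v * L + \<bar>x v\<bar> * h \<le> h * L" and w: "y w * L + \<bar>x w\<bar> * h \<le> h * L"
    using assms by (auto simp: fits_def)
  have "y w * L = y v * L + h * L" using assms by (simp add: algebra_simps flip: distrib_right)
  then have "y v * L + \<bar>x w\<bar> * h \<le> 0" using w by linarith
  moreover have "0 \<le> y v * L" "0 \<le> \<bar>x w\<bar> * h" using v assms by auto
  ultimately have "y v * L = 0" "\<bar>x w\<bar> * h = 0" by linarith+
  then show ?thesis using assms by (auto simp: extremal_def)
qed

text \<open>From \<open>v\<close> the other vertices are seen in directions between 0 and pi/4.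
  Hence the angle at \<open>v\<close> is at most pi/4, which is the premise of
  \<open>corner_bound\<close>.\<close>

lemma sector_extremal:
  assumes t: "tight x y h L v u w" and low: "y v \<le> y u" "y v \<le> y w"
    and left: "y u - x u \<le> y v - x v" "y w - x w \<le> y v - x v"
    and pos: "0 < scross x y v u w"
  shows "extremal x y h L v u w"
proof -
  define u1 u2 w1 w2 where uw: "u1 = x u - x v" "u2 = y u - y v" "w1 = x w - x v" "w2 = y w - y v"
  have s: "sdot x y v u w = u1 * w1 + u2 * w2" "scross x y v u w = u1 * w2 - u2 * w1"
    by (auto simp: sdot_def scross_def uw)
  have hL: "0 < h" "0 < L" and f: "fits x y h L v" "fits x y h L w" and c: "corner_bound x y h L v u w"
    using t by (auto simp: tight_def)
  have o: "0 \<le> u2" "0 \<le> w2" "u2 \<le> u1" "w2 \<le> w1" using low left uw by auto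
  then have "0 \<le> u1 * (w1 - w2) + u2 * (w1 + w2)" by auto
  then have "\<bar>scross x y v u w\<bar> \<le> sdot x y v u w"
    using pos unfolding s by (simp add: algebra_simps)
  with c pos have b: "h * L * (u1\<^sup>2 + u2\<^sup>2) \<le> (u1 * w2 - u2 * w1) * (u1 * w1 + u2 * w2)"
    unfolding corner_bound_def s by (simp add: uw)
  have p: "w2 * L + w1 * h \<le> 2 * (h * L)"
    using fits_pair_shift[OF f(2,1) hL, of "2 * y v"] f(1) by (simp add: uw fits_def)
  have "u2 = 0" "w1 = L" "w2 = h"
    using sector_rigid[OF hL o(1,2,3,4) _ p b] pos s by auto
  then show ?thesis using hL f uw by (intro extremalI) auto
qed

text \<open>Here the small angle is at \<open>u\<close>, not at the lowest vertex \<open>v\<close>: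
  \<open>flat_pair_angle\<close> supplies the premise of \<open>corner_bound\<close> at
  \<open>u\<close>.\<close>

lemma flat_pair_extremal:
  assumes t: "tight x y h L v u w" and low: "y v \<le> y u" "y v \<le> y w"
    and left: "y v - x v \<le> y w - x w"
    and flat: "y u - y v < x u - x v" "y u + y w - 2 * y v < x u - x w"
  shows "extremal x y h L u v w"
proof -
  define u1 u2 w1 w2 where uw: "u1 = x u - x v" "u2 = y u - y v" "w1 = x w - x v" "w2 = y w - y v"
  have s: "sdot x y u v w = u1 * (u1 - w1) + u2 * (u2 - w2)"
    "scross x y u v w = - (u1 * w2 - u2 * w1)" "scross x y v u w = u1 * w2 - u2 * w1"
    "sdot x y v u w = u1 * w1 + u2 * w2"
    by (auto simp: sdot_def scross_def uw algebra_simps)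
  have hL: "0 < h" "0 < L" and f: "fits x y h L v" "fits x y h L w" "fits x y h L u"
    and c: "corner_bound x y h L u v w" and ne: "scross x y v u w \<noteq> 0" and acute: "sdot x y v u w > 0"
    using t by (auto simp: tight_def)
  have o: "0 \<le> u2" "0 \<le> w2" "u2 < u1" "w1 < u1" "w1 \<le> w2" "u2 + w2 < u1 - w1"
    using low left flat uw by auto
  \<comment> \<open>\<open>u\<close> lies below the diagonal through \<open>v\<close> and
    \<open>w\<close> on or above it, and neither is lower than \<open>v\<close>; so the turn from
    \<open>u\<close> to \<open>w\<close> is counterclockwise.\<close>
  have "0 \<le> u1 * w2 - u2 * w1"
  proof (cases "w1 \<le> 0")
    case True
    then have "u2 * w1 \<le> 0" "0 \<le> u1 * w2" using o by (auto simp: mult_le_0_iff)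
    then show ?thesis by linarith
  next
    case False
    then have "u2 * w1 \<le> u1 * w1" "u1 * w1 \<le> u1 * w2" using o by (auto intro: mult_mono)
    then show ?thesis by linarith
  qed
  then have pos: "0 < u1 * w2 - u2 * w1" using ne s by linarith
  have "\<bar>scross x y u v w\<bar> \<le> sdot x y u v w"
    using flat_pair_angle[of u2 w2 u1 w1] o acute pos unfolding s by simp
  with c have b0: "\<forall>z\<in>{v, w}. h * L * ((x z - x u)\<^sup>2 + (y z - y u)\<^sup>2)
      \<le> (u1 * w2 - u2 * w1) * (u1 * (u1 - w1) + u2 * (u2 - w2))"
    unfolding corner_bound_def using pos by (simp add: s)
  have sq: "(x v - x u)\<^sup>2 = u1\<^sup>2" "(y v - y u)\<^sup>2 = u2\<^sup>2" "(x w - x u)\<^sup>2 = (u1 - w1)\<^sup>2"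
    "(y w - y u)\<^sup>2 = (u2 - w2)\<^sup>2"
    by (simp_all add: uw power2_commute)
  have b: "h * L * (u1\<^sup>2 + u2\<^sup>2) \<le> (u1 * w2 - u2 * w1) * (u1 * (u1 - w1) + u2 * (u2 - w2))"
    "h * L * ((u1 - w1)\<^sup>2 + (u2 - w2)\<^sup>2)
         \<le> (u1 * w2 - u2 * w1) * (u1 * (u1 - w1) + u2 * (u2 - w2))"
    using b0 by (simp_all add: sq)
  have p: "(u2 + w2) * L + (u1 - w1) * h \<le> 2 * (h * L)" "u2 * L + u1 * h \<le> 2 * (h * L)"
    using fits_pair_shift[OF f(3,2) hL, of "2 * y v"] fits_pair_shift[OF f(3,1) hL, of "2 * y v"] f(1)
    by (simp_all add: uw fits_def)
  have "u2 = 0" "u1 - w1 = L" "w2 = h"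
    using flat_pair_rigid[OF hL o(1-4) p b] by auto
  then show ?thesis using hL f uw by (intro extremalI) auto
qed

section \<open>Choice of the vertices under the two legs\<close>

lemma ex_max_of_three:
  fixes f :: "'v \<Rightarrow> real"
  shows "\<exists>p\<in>{v, u, w}. \<forall>z\<in>{v, u, w}. f z \<le> f p"
proof -
  have "Max (f ` {v, u, w}) \<in> f ` {v, u, w}" by (intro Max_in) auto
  then obtain p where "p \<in> {v, u, w}" "f p = Max (f ` {v, u, w})" by (metis imageE)
  then show ?thesis by (intro bexI[of _ p]) (auto intro!: Max_ge)
qed

definition extremal_some :: "('v \<Rightarrow> real) \<Rightarrow> ('v \<Rightarrow> real) \<Rightarrow> real \<Rightarrow> real \<Rightarrow> 'v \<Rightarrow> 'v \<Rightarrow> 'v \<Rightarrow> bool"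
  where "extremal_some x y h L v u w \<longleftrightarrow>
     extremal x y h L v u w \<or> extremal x y h L v w u \<or> extremal x y h L u v w \<or>
     extremal x y h L u w v \<or> extremal x y h L w v u \<or> extremal x y h L w u v"

lemma sector_extremal_some:
  assumes t: "tight x y h L v u w" and low: "y v \<le> y u" "y v \<le> y w"
    and left: "y u - x u \<le> y v - x v" "y w - x w \<le> y v - x v"
  shows "extremal_some x y h L v u w"
proof (cases "0 < scross x y v u w")
  case True
  then show ?thesis using sector_extremal[OF t low left] by (simp add: extremal_some_def)
next
  case False
  then have "0 < scross x y v w u" using t by (simp add: tight_def scross_swap[of x y v w u])
  then show ?thesis using sector_extremal[OF tight_swap[OF t] low(2,1) left(2,1)]
    by (simp add: extremal_some_def)
qed

lemma opposite_pair_extremal_some: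
  assumes t: "tight x y h L v u w" and low: "y v \<le> y u" "y v \<le> y w"
    and right: "x v + y v \<le> x u + y u" and left: "y v - x v \<le> y w - x w"
    and sq: "(y u + y w - 2 * y v)\<^sup>2 * L \<le> (x u - x w)\<^sup>2 * h"
  shows "extremal_some x y h L v u w"
proof -
  define X Y where XY: "X = x u - x w" "Y = y u + y w - 2 * y v"
  have hL: "0 < h" "h < L" and ne: "scross x y v u w \<noteq> 0" using t by (auto simp: tight_def)
  have Y: "0 \<le> Y" and S: "0 \<le> X + Y" using low left right by (auto simp: XY)
  have "Y \<noteq> 0"
  proof
    assume "Y = 0"
    then have "y u = y v" "y w = y v" using low by (auto simp: XY)
    then show False using ne by (simp add: scross_def)
  qed
  \<comment> \<open>Since \<open>h < L\<close>, the weak weighted comparison becomes a strict one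
    between \<open>Y\<^sup>2\<close> and \<open>X\<^sup>2\<close>.\<close>
  then have "Y\<^sup>2 * h < Y\<^sup>2 * L" using hL by simp
  then have "Y\<^sup>2 * h < X\<^sup>2 * h" using sq by (simp add: XY)
  then have lt: "Y\<^sup>2 < X\<^sup>2" using hL by simp
  have "Y < X"
  proof (rule ccontr)
    assume "\<not> Y < X"
    then have "\<bar>X\<bar> \<le> \<bar>Y\<bar>" using S Y by auto
    then have "X\<^sup>2 \<le> Y\<^sup>2" by (simp add: abs_le_square_iff)
    then show False using lt by simp
  qed
  \<comment> \<open>\<open>X - Y\<close> is the sum of the margins in these two inequalities, so one
    of them is positive. The second case is the mirror image of the first.\<close>
  then consider "y u - y v < x u - x v" | "y w - y v < x v - x w" using XY by force
  then show ?thesis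
  proof cases
    case 1
    then show ?thesis using flat_pair_extremal[OF t low left] \<open>Y < X\<close>
      by (simp add: extremal_some_def XY)
  next
    case 2
    have "extremal (\<lambda>z. - x z) y h L w v u"
      using flat_pair_extremal[OF tight_mirror[OF tight_swap[OF t]] low(2,1)] 2 right \<open>Y < X\<close>
      by (simp add: XY)
    then show ?thesis by (simp add: mirror_simps extremal_some_def)
  qed
qed

text \<open>The right isosceles container with its base at height \<open>y v\<close> touches the
  vertices at \<open>p\<close> and \<open>q\<close>. If one of these is \<open>v\<close>, the other
  vertices lie in a sector of opening pi/4 at \<open>v\<close>; otherwise \<open>p\<close> and
  \<open>q\<close> are the two remaining vertices and the flatness comparison decides.\<close>

lemma lowest_extremal_some:
  assumes t: "tight x y h L v u w" and low: "y v \<le> y u" "y v \<le> y w"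
  shows "extremal_some x y h L v u w"
proof -
  obtain p where p: "p \<in> {v, u, w}" "\<forall>z\<in>{v, u, w}. x z + y z \<le> x p + y p"
    using ex_max_of_three[of v u w "\<lambda>z. x z + y z"] by blast
  obtain q where q: "q \<in> {v, u, w}" "\<forall>z\<in>{v, u, w}. y z - x z \<le> y q - x q"
    using ex_max_of_three[of v u w "\<lambda>z. y z - x z"] by blast
  have hL: "0 < h" "h < L" and f: "\<forall>z\<in>{v, u, w}. fits x y h L z" and rb: "right_bound x y h L {v, u, w}"
    and ne: "scross x y v u w \<noteq> 0"
    using t by (auto simp: tight_def)
  have lowz: "\<forall>z\<in>{v, u, w}. y v \<le> y z" using low by auto
  have area: "h * L \<le> (x p + y p + (y q - x q) - 2 * y v)\<^sup>2 / 4"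
    using rb p(2) q(2) lowz unfolding right_bound_def by blast
  have sq: "(y p + y q - 2 * y v)\<^sup>2 * L \<le> (x p - x q)\<^sup>2 * h"
  proof (rule right_shape_compare)
    show "0 < h" "h < L" using hL by auto
    show "0 \<le> y p + y q - 2 * y v" using lowz p(1) q(1) by fastforce
    show "0 \<le> x p - x q + (y p + y q - 2 * y v)" using p(2) q(2) by auto
    show "(y p + y q - 2 * y v) * L + (x p - x q) * h \<le> 2 * (h * L)"
      using f p(1) q(1) hL by (intro fits_pair_shift) (auto simp: fits_def)
    show "h * L \<le> (x p - x q + (y p + y q - 2 * y v))\<^sup>2 / 4"
      using area by (simp add: algebra_simps)
  qed
  \<comment> \<open>With \<open>p = q\<close> the horizontal difference vanishes, so
    \<open>sq\<close> puts \<open>p\<close> at the lowest height; being maximal in both directions,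
    \<open>p\<close> is then also highest, and all vertices are level.\<close>
  have "p \<noteq> q"
  proof
    assume "p = q"
    then have "(y p - y v)\<^sup>2 * (4 * L) \<le> 0" using sq by (simp add: power2_eq_square algebra_simps)
    then have "y p = y v" using hL by (simp add: mult_le_0_iff)
    then have "y u = y v" "y w = y v" using p(2) q(2) low \<open>p = q\<close> by force+
    then show False using ne by (simp add: scross_def)
  qed
  consider "q = v" | "p = v" | "p = u" "q = w" | "p = w" "q = u"
    using p(1) q(1) \<open>p \<noteq> q\<close> by auto
  then show ?thesis
  proof cases
    case 1
    then show ?thesis using sector_extremal_some[OF t low] q(2) by auto
  next
    case 2
    have "extremal_some (\<lambda>z. - x z) y h L v u w"
      using sector_extremal_some[OF tight_mirror[OF t] low] p(2) 2 by (auto simp: algebra_simps)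
    then show ?thesis by (simp add: extremal_some_def mirror_simps)
  next
    case 3
    then show ?thesis using opposite_pair_extremal_some[OF t low] p(2) q(2) sq by auto
  next
    case 4
    have "extremal_some x y h L v w u"
      using opposite_pair_extremal_some[OF tight_swap[OF t] low(2,1)] p(2) q(2) sq 4 by auto
    then show ?thesis by (auto simp: extremal_some_def)
  qed
qed

lemma tight_extremal_some:
  assumes t: "tight x y h L v u w"
  shows "extremal_some x y h L v u w"
proof -
  consider "y v \<le> y u" "y v \<le> y w" | "y u \<le> y v" "y u \<le> y w" | "y w \<le> y v" "y w \<le> y u"
    by linarith
  then show ?thesis
  proof cases
    case 1
    then show ?thesis using lowest_extremal_some[OF t] by simp
  next
    case 2
    then show ?thesis using lowest_extremal_some[OF tight_rot[OF t]] by (auto simp: extremal_some_def)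
  next
    case 3
    then show ?thesis using lowest_extremal_some[OF tight_rot[OF tight_swap[OF t]]]
      by (auto simp: extremal_some_def)
  qed
qed

section \<open>Triangles in the plane\<close>

abbreviation vdot :: "point \<Rightarrow> point \<Rightarrow> point \<Rightarrow> real" where
  "vdot P Q R \<equiv> (Q - P) \<bullet> (R - P)"

abbreviation vcross :: "point \<Rightarrow> point \<Rightarrow> point \<Rightarrow> real" where
  "vcross \<equiv> scross (\<lambda>Z. Z $ 1) (\<lambda>Z. Z $ 2)"

lemma inner_2: "u \<bullet> v = u $ 1 * v $ 1 + u $ 2 * v $ 2" for u v :: point
  by (simp add: inner_vec_def sum_2)

lemma dist_sq: "(dist P Q)\<^sup>2 = (P - Q) \<bullet> (P - Q)" for P Q :: point
  by (simp add: dist_norm power2_norm_eq_inner)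

lemma lagrange: "(vcross P Q R)\<^sup>2 = (dist P Q)\<^sup>2 * (dist P R)\<^sup>2 - (vdot P Q R)\<^sup>2"
  unfolding dist_sq by (simp add: inner_2 scross_def power2_eq_square algebra_simps)

text \<open>The equality case of Cauchy-Schwarz, rewritten by \<open>lagrange\<close>.\<close>

lemma collinear_iff_vcross: "collinear {P, Q, R} \<longleftrightarrow> vcross P Q R = 0"
proof -
  have "collinear {P, Q, R} \<longleftrightarrow> collinear {Q, P, R}" by (simp add: insert_commute)
  also have "\<dots> \<longleftrightarrow> collinear {0, Q - P, R - P}"
    by (rule collinear_3) (simp add: NO_MATCH_def)
  also have "\<dots> \<longleftrightarrow> \<bar>vdot P Q R\<bar> = dist P Q * dist P R"
    by (simp add: norm_cauchy_schwarz_equal[symmetric] dist_norm norm_minus_commute)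
  also have "\<dots> \<longleftrightarrow> (vdot P Q R)\<^sup>2 = (dist P Q * dist P R)\<^sup>2"
    using power2_eq_iff_nonneg[of "\<bar>vdot P Q R\<bar>" "dist P Q * dist P R"] by simp
  also have "\<dots> \<longleftrightarrow> (vcross P Q R)\<^sup>2 = 0"
    unfolding lagrange by (auto simp: power_mult_distrib)
  finally show ?thesis by simp
qed

lemma measure_triangle: "measure lebesgue (convex hull {P, Q, R}) = \<bar>vcross P Q R\<bar> / 2"
  for P Q R :: point
proof -
  have "convex hull {P, Q, R} \<in> sets borel"
    by (intro borel_compact compact_convex_hull finite_imp_compact) auto
  then have "measure lebesgue (convex hull {P, Q, R}) = measure lborel (convex hull {P, Q, R})"
    by (intro measure_completion) simp
  also have "\<dots> = \<bar>vcross P Q R\<bar> / 2"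
    unfolding content_triangle by (simp add: scross_def abs_minus_commute mult.commute)
  finally show ?thesis .
qed

text \<open>The vertices are the extreme points of the region. This transfers angle conditions from
  existentially quantified vertices to given ones.\<close>

lemma triangle_vertices_unique:
  assumes "triangle_with_vertices P Q R T" "triangle_with_vertices P' Q' R' T"
  shows "{P, Q, R} = {P', Q', R'}"
proof -
  have "{X. X extreme_point_of T} = {P, Q, R}" if "triangle_with_vertices P Q R T" for P Q R
    using that extreme_point_of_convex_hull_affine_independent[of "{P, Q, R}"]
    by (auto simp: triangle_with_vertices_def collinear_3_eq_affine_dependent)
  from this[OF assms(1)] this[OF assms(2)] show ?thesis by simp
qed

lemma angle_iff_vdot:
  assumes "P \<noteq> Q" "R \<noteq> Q"
  shows "angle P Q R < pi / 2 \<longleftrightarrow> 0 < vdot Q P R" "pi / 2 < angle P Q R \<longleftrightarrow> vdot Q P R < 0"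
proof -
  define r where "r = norm (P - Q) * norm (R - Q)"
  have r: "r > 0" using assms by (simp add: r_def)
  have "\<bar>vdot Q P R / r\<bar> \<le> 1"
    using Cauchy_Schwarz_ineq2[of "P - Q" "R - Q"] r by (simp add: r_def)
  then have "arccos (vdot Q P R / r) < arccos 0 \<longleftrightarrow> 0 < vdot Q P R / r"
    "arccos 0 < arccos (vdot Q P R / r) \<longleftrightarrow> vdot Q P R / r < 0"
    using arccos_less_mono[of "vdot Q P R / r" 0] arccos_less_mono[of 0 "vdot Q P R / r"]
    by simp_all
  then show "angle P Q R < pi / 2 \<longleftrightarrow> 0 < vdot Q P R" "pi / 2 < angle P Q R \<longleftrightarrow> vdot Q P R < 0"
    using r by (auto simp: angle_def r_def zero_less_divide_iff divide_less_0_iff)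
qed

lemma triangle_distinct:
  assumes "triangle_with_vertices P Q R T"
  shows "P \<noteq> Q" "P \<noteq> R" "Q \<noteq> R"
  using assms by (auto simp: triangle_with_vertices_def insert_commute)

lemma acute_triangle_vdot:
  assumes "triangle_with_vertices A B C T" "acute_triangle T"
  shows "0 < vdot A B C" "0 < vdot B A C" "0 < vdot C A B"
proof -
  obtain P Q R where t: "triangle_with_vertices P Q R T" and
    "angle Q P R < pi / 2" "angle P Q R < pi / 2" "angle P R Q < pi / 2"
    using assms(2) unfolding acute_triangle_def by blast
  note d = triangle_distinct[OF t]
  have "0 < vdot P Q R" "0 < vdot Q P R" "0 < vdot R P Q"
    using angle_iff_vdot(1)[of Q P R] angle_iff_vdot(1)[of P Q R] angle_iff_vdot(1)[of P R Q] d
      \<open>angle Q P R < pi / 2\<close> \<open>angle P Q R < pi / 2\<close> \<open>angle P R Q < pi / 2\<close> by auto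
  then have all: "\<forall>X\<in>{P, Q, R}. \<forall>Y\<in>{P, Q, R}. \<forall>Z\<in>{P, Q, R}.
      X \<noteq> Y \<longrightarrow> X \<noteq> Z \<longrightarrow> Y \<noteq> Z \<longrightarrow> 0 < vdot X Y Z"
    by (auto simp: inner_commute)
  show "0 < vdot A B C" "0 < vdot B A C" "0 < vdot C A B"
    using all triangle_distinct[OF assms(1)]
    unfolding triangle_vertices_unique[OF t assms(1)] by auto
qed

text \<open>By the law of cosines the scalar product at a base corner is half the squared
  base.\<close>

lemma vdot_base_nonneg:
  assumes "dist P Q = dist P R"
  shows "0 \<le> vdot Q P R"
proof -
  have "(dist P R)\<^sup>2 = (dist P Q)\<^sup>2 + (dist Q R)\<^sup>2 - 2 * vdot Q P R"
    unfolding dist_sq by (simp add: inner_diff inner_commute algebra_simps)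
  then have "2 * vdot Q P R = (dist Q R)\<^sup>2" using assms by simp
  then show ?thesis by (metis zero_le_power2 zero_le_mult_iff zero_less_numeral not_less)
qed

text \<open>Base angles are never obtuse, so the obtuse angle sits at the apex.\<close>

lemma obtuse_isosceles_apex:
  assumes "isosceles_triangle T" "obtuse_triangle T"
  obtains P Q R where "triangle_with_vertices P Q R T" "dist P Q = dist P R" "vdot P Q R < 0"
proof -
  obtain P0 Q0 R0 where "triangle_with_vertices P0 Q0 R0 T"
    "dist P0 Q0 = dist P0 R0 \<or> dist Q0 P0 = dist Q0 R0 \<or> dist R0 P0 = dist R0 Q0"
    using assms(1) unfolding isosceles_triangle_def by blast
  then obtain P Q R where t: "triangle_with_vertices P Q R T" and eq: "dist P Q = dist P R"
  proof (elim disjE)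
    assume "dist P0 Q0 = dist P0 R0"
    then show ?thesis using that \<open>triangle_with_vertices P0 Q0 R0 T\<close> by blast
  next
    assume "dist Q0 P0 = dist Q0 R0"
    then show ?thesis using that[of Q0 P0 R0] \<open>triangle_with_vertices P0 Q0 R0 T\<close>
      by (simp add: triangle_with_vertices_def insert_commute)
  next
    assume "dist R0 P0 = dist R0 Q0"
    then show ?thesis using that[of R0 P0 Q0] \<open>triangle_with_vertices P0 Q0 R0 T\<close>
      by (simp add: triangle_with_vertices_def insert_commute)
  qed
  obtain X Y Z where t': "triangle_with_vertices X Y Z T"
    and o: "pi / 2 < angle Y X Z \<or> pi / 2 < angle X Y Z \<or> pi / 2 < angle X Z Y"
    using assms(2) unfolding obtuse_triangle_def by blast
  have "vdot X Y Z < 0 \<or> vdot Y X Z < 0 \<or> vdot Z X Y < 0"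
    using o angle_iff_vdot(2)[of Y X Z] angle_iff_vdot(2)[of X Y Z] angle_iff_vdot(2)[of X Z Y]
      triangle_distinct[OF t'] by auto
  moreover have "0 \<le> vdot Q P R" "0 \<le> vdot R P Q"
    using vdot_base_nonneg[of P Q R] vdot_base_nonneg[of P R Q] eq by auto
  moreover have "0 \<le> vdot X Y Z" "0 \<le> vdot Y X Z" "0 \<le> vdot Z X Y"
    if "0 \<le> vdot P Q R" "0 \<le> vdot Q P R" "0 \<le> vdot R P Q"
  proof -
    have all: "\<forall>X\<in>{P, Q, R}. \<forall>Y\<in>{P, Q, R}. \<forall>Z\<in>{P, Q, R}.
        X \<noteq> Y \<longrightarrow> X \<noteq> Z \<longrightarrow> Y \<noteq> Z \<longrightarrow> 0 \<le> vdot X Y Z"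
      using that by (auto simp: inner_commute)
    then show "0 \<le> vdot X Y Z" "0 \<le> vdot Y X Z" "0 \<le> vdot Z X Y"
      using triangle_distinct[OF t'] unfolding triangle_vertices_unique[OF t t'] by auto
  qed
  ultimately have "vdot P Q R < 0" by (meson not_less)
  with t eq that show ?thesis by blast
qed

section \<open>Containers obtained by lengthening one side\<close>

lemma stretch_vcross: "vcross P Q (P + k *\<^sub>R (R - P)) = k * vcross P Q R"
  by (simp add: scross_def algebra_simps)

lemma triangle_stretch:
  assumes "\<not> collinear {P, Q, R}" "1 \<le> k"
  defines "S \<equiv> P + k *\<^sub>R (R - P)"
  shows "triangle_with_vertices P Q S (convex hull {P, Q, S})"
    and "convex hull {P, Q, R} \<subseteq> convex hull {P, Q, S}"
    and "measure lebesgue (convex hull {P, Q, S}) = k * (\<bar>vcross P Q R\<bar> / 2)"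
proof -
  show "triangle_with_vertices P Q S (convex hull {P, Q, S})"
    using assms by (simp add: triangle_with_vertices_def collinear_iff_vcross stretch_vcross)
  have "R = P + (1 / k) *\<^sub>R (S - P)"
    using assms(2) by (simp add: S_def)
  also have "\<dots> = (1 - 1 / k) *\<^sub>R P + (1 / k) *\<^sub>R S"
    by (simp add: scaleR_diff_left scaleR_diff_right)
  finally have "R = (1 - 1 / k) *\<^sub>R P + (1 / k) *\<^sub>R S" .
  moreover have "0 \<le> 1 / k" "1 / k \<le> 1" using assms(2) by auto
  ultimately have "R \<in> closed_segment P S"
    unfolding closed_segment_def by blast
  then have "R \<in> convex hull {P, Q, S}"
    unfolding segment_convex_hull using hull_mono[of "{P, S}" "{P, Q, S}" convex] by blast
  then show "convex hull {P, Q, R} \<subseteq> convex hull {P, Q, S}"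
    by (intro hull_minimal) (auto simp: hull_inc)
  show "measure lebesgue (convex hull {P, Q, S}) = k * (\<bar>vcross P Q R\<bar> / 2)"
    using assms(2) by (simp add: measure_triangle S_def stretch_vcross abs_mult)
qed

text \<open>Apart from the right isosceles triangles, all comparison containers arise by pushing one
  vertex outward along a side, which multiplies the area by the same factor.\<close>

lemma min_area_le_stretch:
  assumes min: "min_area_isosceles_container (convex hull {P, Q, R}) T'"
    and "\<not> collinear {P, Q, R}" "1 \<le> k"
    and iso: "dist P Q = dist P (P + k *\<^sub>R (R - P)) \<or> dist Q P = dist Q (P + k *\<^sub>R (R - P))"
  shows "measure lebesgue T' \<le> k * (\<bar>vcross P Q R\<bar> / 2)"
proof -
  let ?T = "convex hull {P, Q, P + k *\<^sub>R (R - P)}"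
  note s = triangle_stretch[OF assms(2,3)]
  have "isosceles_container (convex hull {P, Q, R}) ?T"
    using s(1,2) iso unfolding isosceles_container_def isosceles_triangle_def by blast
  then show ?thesis
    using min s(3) unfolding min_area_isosceles_container_def by auto
qed

lemma dist_on_ray: "0 \<le> k \<Longrightarrow> dist P (P + k *\<^sub>R (R - P)) = k * dist P R" for P R :: point
  by (simp add: dist_norm norm_minus_commute)

text \<open>The equation is quadratic in \<open>k\<close> with the trivial root 0; the other root
  gives the second intersection of the line with the circle about \<open>Q\<close> through
  \<open>P\<close>.\<close>

lemma dist_stretch_eq_iff:
  assumes "k \<noteq> 0"
  shows "dist (P + k *\<^sub>R (R - P)) Q = dist P Q \<longleftrightarrow> k * (dist P R)\<^sup>2 = 2 * vdot P R Q"
proof -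
  have "(dist (P + k *\<^sub>R (R - P)) Q)\<^sup>2 - (dist P Q)\<^sup>2 = k * (k * (dist P R)\<^sup>2 - 2 * vdot P R Q)"
    unfolding dist_sq by (simp add: inner_2 algebra_simps)
  then have "(dist (P + k *\<^sub>R (R - P)) Q)\<^sup>2 = (dist P Q)\<^sup>2 \<longleftrightarrow> k * (dist P R)\<^sup>2 = 2 * vdot P R Q"
    using assms by auto
  then show ?thesis by simp
qed

section \<open>Coordinates adapted to an obtuse isosceles triangle\<close>

lemma orthonormal_expansion:
  fixes e1 e2 u v :: point
  assumes "e1 \<bullet> e1 = 1" "e2 \<bullet> e2 = 1" "e1 \<bullet> e2 = 0"
  shows inner_orthonormal: "u \<bullet> v = (u \<bullet> e1) * (v \<bullet> e1) + (u \<bullet> e2) * (v \<bullet> e2)"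
    and "u = (u \<bullet> e1) *\<^sub>R e1 + (u \<bullet> e2) *\<^sub>R e2"
proof -
  have *: "u \<bullet> v = (u \<bullet> e1) * (v \<bullet> e1) + (u \<bullet> e2) * (v \<bullet> e2)" for u v
  proof -
    define a b c d where "a = e1 $ 1" "b = e1 $ 2" "c = e2 $ 1" "d = e2 $ 2"
    note [simp] = this(1-4)[symmetric]
    have r: "a * a + b * b = 1" "c * c + d * d = 1" "a * c + b * d = 0"
      using assms by (simp_all add: inner_2)
    \<comment> \<open>The determinant of the frame is 1 or -1, and \<open>e2\<close> is
      \<open>D\<close> times \<open>e1\<close> turned by a right angle. This treats both
      orientations at once and shows that the rows are orthonormal as well.\<close>
    define D where "D = a * d - b * c"
    have D: "D * D = 1" using r unfolding D_def by algebra
    have "c = - b * D" "d = a * D" using r unfolding D_def by algebra+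
    then have "a * a + c * c = 1" "b * b + d * d = 1" "a * b + c * d = 0"
      using r D by algebra+
    then have "u $ 1 * v $ 1 + u $ 2 * v $ 2 = (u $ 1 * a + u $ 2 * b) * (v $ 1 * a + v $ 2 * b)
        + (u $ 1 * c + u $ 2 * d) * (v $ 1 * c + v $ 2 * d)"
      by algebra
    then show ?thesis by (simp add: inner_2)
  qed
  show "u \<bullet> v = (u \<bullet> e1) * (v \<bullet> e1) + (u \<bullet> e2) * (v \<bullet> e2)" by (rule *)
  define w where "w = u - ((u \<bullet> e1) *\<^sub>R e1 + (u \<bullet> e2) *\<^sub>R e2)"
  have "w \<bullet> e1 = 0" "w \<bullet> e2 = 0"
    using assms inner_commute[of e2 e1] by (simp_all add: w_def inner_diff_left inner_add_left)
  then have "w \<bullet> w = 0" using *[of w w] by simp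
  then show "u = (u \<bullet> e1) *\<^sub>R e1 + (u \<bullet> e2) *\<^sub>R e2" by (simp add: w_def)
qed

lemma obtuse_isosceles_frame:
  assumes "triangle_with_vertices P Q R T" "dist P Q = dist P R" "vdot P Q R < 0"
  obtains M e1 e2 :: point and h L :: real
  where "e1 \<bullet> e1 = 1" "e2 \<bullet> e2 = 1" "e1 \<bullet> e2 = 0" "0 < h" "h < L"
    and "P = M + h *\<^sub>R e2" "Q = M - L *\<^sub>R e1" "R = M + L *\<^sub>R e1"
proof -
  define M where "M = (1 / 2) *\<^sub>R (Q + R)"
  define h L where "h = norm (P - M)" and "L = norm (R - Q) / 2"
  define e1 e2 where "e1 = (1 / (2 * L)) *\<^sub>R (R - Q)" and "e2 = (1 / h) *\<^sub>R (P - M)"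
  have nc: "vcross P Q R \<noteq> 0"
    using assms(1) by (simp add: triangle_with_vertices_def collinear_iff_vcross)
  have "P \<noteq> M"
  proof
    assume "P = M"
    then have "vcross P Q R = 0" unfolding M_def by (simp add: scross_def field_simps)
    then show False using nc by simp
  qed
  then have h: "h > 0" by (simp add: h_def)
  have L: "L > 0" using triangle_distinct[OF assms(1)] by (simp add: L_def)
  have hh: "(P - M) \<bullet> (P - M) = h * h" and LL: "(R - Q) \<bullet> (R - Q) = 4 * (L * L)"
    by (simp_all add: h_def L_def flip: power2_norm_eq_inner power2_eq_square)
      (simp add: power2_eq_square)
  have "2 * ((R - Q) \<bullet> (P - M)) = (dist P Q)\<^sup>2 - (dist P R)\<^sup>2"
    unfolding dist_sq by (simp add: M_def inner_2 field_simps)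
  then have perp: "(R - Q) \<bullet> (P - M) = 0" using assms(2) by simp
  \<comment> \<open>The scalar product at the apex is \<open>h * h - L * L\<close>, so an obtuse
    apex means \<open>h < L\<close>.\<close>
  have "vdot P Q R = (P - M) \<bullet> (P - M) - (R - Q) \<bullet> (R - Q) / 4"
    by (simp add: M_def inner_2 field_simps)
  then have "h * h < L * L" using assms(3) by (simp add: hh LL)
  then have "h < L" using h L by (metis mult_mono' less_imp_le not_less)
  moreover have "e1 \<bullet> e1 = 1" "e2 \<bullet> e2 = 1" "e1 \<bullet> e2 = 0"
    using h L by (simp_all add: e1_def e2_def hh LL perp)
  moreover have "P = M + h *\<^sub>R e2" using h by (simp add: e2_def)
  moreover have "L *\<^sub>R e1 = (1 / 2) *\<^sub>R (R - Q)" using L by (simp add: e1_def)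
  then have "Q = M - L *\<^sub>R e1" "R = M + L *\<^sub>R e1"
    by (simp_all add: M_def vec_eq_iff field_simps)
  ultimately show ?thesis using that h by blast
qed

lemma scross_sq:
  "(scross x y v u w)\<^sup>2 = sdot x y v u u * sdot x y v w w - (sdot x y v u w)\<^sup>2"
  by (simp add: scross_def sdot_def power2_eq_square algebra_simps)

locale frame =
  fixes M e1 e2 :: point
  assumes orthonormal: "e1 \<bullet> e1 = 1" "e2 \<bullet> e2 = 1" "e1 \<bullet> e2 = 0"
begin

definition xc :: "point \<Rightarrow> real" where "xc Z = (Z - M) \<bullet> e1"
definition yc :: "point \<Rightarrow> real" where "yc Z = (Z - M) \<bullet> e2"
definition pt :: "real \<Rightarrow> real \<Rightarrow> point" where "pt a b = M + a *\<^sub>R e1 + b *\<^sub>R e2"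

lemma coords_pt [simp]: "xc (pt a b) = a" "yc (pt a b) = b"
  using orthonormal inner_commute[of e2 e1]
  by (simp_all add: xc_def yc_def pt_def inner_diff_left inner_add_left)

lemma pt_coords [simp]: "pt (xc Z) (yc Z) = Z"
  using orthonormal_expansion(2)[OF orthonormal, of "Z - M"]
  unfolding pt_def xc_def yc_def by (simp add: algebra_simps)

lemma pt_eqI: "xc Z = a \<Longrightarrow> yc Z = b \<Longrightarrow> Z = pt a b"
  using pt_coords by metis

lemma sdot_coords: "sdot xc yc v u w = vdot v u w"
proof -
  have "xc u - xc v = (u - v) \<bullet> e1" "yc u - yc v = (u - v) \<bullet> e2" for u v
    by (simp_all add: xc_def yc_def inner_diff_left)
  then show ?thesis
    unfolding sdot_def using inner_orthonormal[OF orthonormal, of "u - v" "w - v"] by simp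
qed

text \<open>The frame may reverse orientation, so only absolute values agree; both squares are the
  same Gram determinant.\<close>

lemma scross_coords: "\<bar>scross xc yc v u w\<bar> = \<bar>vcross v u w\<bar>"
proof -
  have "(scross xc yc v u w)\<^sup>2 = (vcross v u w)\<^sup>2"
    unfolding lagrange scross_sq sdot_coords dist_sq by (simp add: inner_commute inner_diff algebra_simps)
  then show ?thesis by (simp only: power2_eq_iff abs_eq_iff)
qed

lemma dist_coords: "(dist Z W)\<^sup>2 = (xc W - xc Z)\<^sup>2 + (yc W - yc Z)\<^sup>2"
  using sdot_coords[of Z W W] unfolding dist_sq
  by (simp add: sdot_def power2_eq_square inner_commute inner_diff algebra_simps)

lemma measure_triangle_coords:
  "measure lebesgue (convex hull {P, Q, R}) = \<bar>scross xc yc P Q R\<bar> / 2"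
  by (simp add: measure_triangle scross_coords)

lemma fits_in_triangle:
  assumes "Z \<in> convex hull {pt 0 h, pt (- L) 0, pt L 0}" "0 < h" "0 < L"
  shows "fits xc yc h L Z"
proof -
  obtain u v w where Z: "Z = u *\<^sub>R pt 0 h + v *\<^sub>R pt (- L) 0 + w *\<^sub>R pt L 0"
    and uvw: "0 \<le> u" "0 \<le> v" "0 \<le> w" "u + v + w = 1"
    using assms(1) unfolding convex_hull_3 by blast
  have "Z = (u + v + w) *\<^sub>R M + ((w - v) * L) *\<^sub>R e1 + (u * h) *\<^sub>R e2"
    unfolding Z pt_def by (simp add: algebra_simps)
  then have "Z = pt ((w - v) * L) (u * h)" by (simp add: uvw pt_def)
  then have c: "xc Z = (w - v) * L" "yc Z = u * h" by simp_all
  have "u + \<bar>w - v\<bar> \<le> 1" using uvw by auto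
  then have "(u + \<bar>w - v\<bar>) * (h * L) \<le> h * L" using assms by (simp add: mult_left_le_one_le)
  moreover have "yc Z * L + \<bar>xc Z\<bar> * h = (u + \<bar>w - v\<bar>) * (h * L)"
    unfolding c abs_mult distrib_right using assms by (simp add: mult_ac)
  ultimately show ?thesis using uvw assms by (simp add: fits_def c)
qed

lemma in_right_triangle:
  assumes "m \<le> yc Z" "xc Z + yc Z \<le> r" "yc Z - xc Z \<le> s" "0 < r + s - 2 * m"
  shows "Z \<in> convex hull {pt ((r - s) / 2) ((r + s) / 2), pt (m - s) m, pt (r - m) m}"
proof -
  \<comment> \<open>\<open>W\<close> is the length of the hypotenuse. The barycentric weights are
    the slacks in the three line constraints, each divided by its value at the opposite
    vertex.\<close>
  define W where "W = r + s - 2 * m"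
  define u v w where "u = 2 * (yc Z - m) / W" and "v = (r - (xc Z + yc Z)) / W"
    and "w = (s - (yc Z - xc Z)) / W"
  have W: "W > 0" using assms by (simp add: W_def)
  have sum: "u + v + w = 1"
    using W unfolding u_def v_def w_def by (simp add: W_def flip: add_divide_distrib)
  have Wuvw: "W * u = 2 * (yc Z - m)" "W * v = r - (xc Z + yc Z)" "W * w = s - (yc Z - xc Z)"
    using W by (simp_all add: u_def v_def w_def)
  have "W * (u * ((r - s) / 2) + v * (m - s) + w * (r - m)) = W * xc Z"
    "W * (u * ((r + s) / 2) + v * m + w * m) = W * yc Z"
    using Wuvw unfolding W_def by (simp_all add: field_simps) algebra+
  then have co: "u * ((r - s) / 2) + v * (m - s) + w * (r - m) = xc Z"
    "u * ((r + s) / 2) + v * m + w * m = yc Z"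
    using W by (simp_all only: mult_cancel_left) auto
  have "u *\<^sub>R pt ((r - s) / 2) ((r + s) / 2) + v *\<^sub>R pt (m - s) m + w *\<^sub>R pt (r - m) m
    = (u + v + w) *\<^sub>R M + (u * ((r - s) / 2) + v * (m - s) + w * (r - m)) *\<^sub>R e1
      + (u * ((r + s) / 2) + v * m + w * m) *\<^sub>R e2"
    unfolding pt_def by (simp only: scaleR_add_left scaleR_add_right scaleR_scaleR) (simp add: add_ac)
  also have "\<dots> = pt (xc Z) (yc Z)" unfolding sum co pt_def by simp
  finally have "Z = u *\<^sub>R pt ((r - s) / 2) ((r + s) / 2) + v *\<^sub>R pt (m - s) m + w *\<^sub>R pt (r - m) m"
    by simp
  moreover have "0 \<le> u" "0 \<le> v" "0 \<le> w"
    using assms W by (auto simp: u_def v_def w_def)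
  ultimately show ?thesis unfolding convex_hull_3 using sum by blast
qed

lemma right_bound_of_min:
  assumes min: "min_area_isosceles_container (convex hull V) T'"
    and area: "measure lebesgue T' = h * L"
    and VV: "V = {A, B, C}" "\<not> collinear V"
  shows "right_bound xc yc h L V"
  unfolding right_bound_def
proof (intro allI impI)
  fix m r s assume b: "\<forall>z\<in>V. m \<le> yc z \<and> xc z + yc z \<le> r \<and> yc z - xc z \<le> s"
  \<comment> \<open>Otherwise adding the two slanted constraints gives \<open>yc z \<le> m\<close>
    for every vertex, so all of them are level.\<close>
  have W: "0 < r + s - 2 * m"
  proof (rule ccontr)
    assume "\<not> 0 < r + s - 2 * m"
    then have "yc A = m" "yc B = m" "yc C = m" using b VV by force+
    then have "scross xc yc A B C = 0" by (simp add: scross_def)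
    then show False using VV collinear_iff_vcross scross_coords[of A B C] by simp
  qed
  define P Q R where "P = pt ((r - s) / 2) ((r + s) / 2)" and "Q = pt (m - s) m" and "R = pt (r - m) m"
  have "V \<subseteq> convex hull {P, Q, R}"
    using b W in_right_triangle unfolding P_def Q_def R_def by auto
  then have sub: "convex hull V \<subseteq> convex hull {P, Q, R}" by (intro hull_minimal) auto
  have cr: "scross xc yc P Q R = (r + s - 2 * m)\<^sup>2 / 2"
    by (simp add: scross_def P_def Q_def R_def power2_eq_square field_simps)
  have "(dist P Q)\<^sup>2 = (dist P R)\<^sup>2"
    unfolding dist_coords by (simp add: P_def Q_def R_def power2_eq_square field_simps)
  then have "dist P Q = dist P R" by simp
  moreover have "\<not> collinear {P, Q, R}"
    using cr W scross_coords[of P Q R] by (auto simp: collinear_iff_vcross)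
  ultimately have "isosceles_container (convex hull V) (convex hull {P, Q, R})"
    using sub unfolding isosceles_container_def isosceles_triangle_def triangle_with_vertices_def
    by blast
  then have "h * L \<le> measure lebesgue (convex hull {P, Q, R})"
    using min area unfolding min_area_isosceles_container_def by auto
  also have "\<dots> = (r + s - 2 * m)\<^sup>2 / 4" unfolding measure_triangle_coords cr by simp
  finally show "h * L \<le> (r + s - 2 * m)\<^sup>2 / 4" .
qed

end

section \<open>Minimal containers of an acute scalene triangle\<close>

text \<open>The angle at \<open>v\<close> is the base angle of the container, whose tangent is h / L
  < 1.\<close>

lemma extremal_corner:
  assumes "extremal x y h L v u w" "fits x y h L u" "0 < h" "h < L" "0 < sdot x y v u w"
  shows "\<bar>scross x y v u w\<bar> = \<bar>x u - x v\<bar> * h" "sdot x y v u w = \<bar>x u - x v\<bar> * L"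
    and "\<bar>scross x y v u w\<bar> < sdot x y v u w"
proof -
  have s: "sdot x y v u w = (x u - x v) * (- x v)" "scross x y v u w = (x u - x v) * h"
    and xv: "\<bar>x v\<bar> = L"
    using assms(1) by (auto simp: extremal_def sdot_def scross_def)
  show 1: "\<bar>scross x y v u w\<bar> = \<bar>x u - x v\<bar> * h" unfolding s using assms by (simp add: abs_mult)
  have "sdot x y v u w = \<bar>sdot x y v u w\<bar>" using assms by simp
  then show 2: "sdot x y v u w = \<bar>x u - x v\<bar> * L" unfolding s abs_mult using xv by simp
  show "\<bar>scross x y v u w\<bar> < sdot x y v u w"
    using assms(3-5) unfolding 1 2 by (auto simp: zero_less_mult_iff)
qed

lemma ray_second_point:
  assumes "D \<in> ray X Y" "D \<noteq> X" "dist D Z = dist X Z"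
  obtains t where "0 < t" "D = X + t *\<^sub>R (Y - X)" "t * (dist X Y)\<^sup>2 = 2 * vdot X Y Z"
proof -
  obtain t where t: "0 \<le> t" "D = X + t *\<^sub>R (Y - X)" using assms(1) unfolding ray_def by blast
  with assms(2) have "t \<noteq> 0" by auto
  with t assms(3) dist_stretch_eq_iff[of t X Y Z] that[of t] show ?thesis by auto
qed

section \<open>Scalar products and angles of the given triangle\<close>

locale acute_scalene =
  fixes A B C :: point
  assumes noncollinear: "\<not> collinear {A, B, C}"
    and acute: "0 < vdot A B C" "0 < vdot B A C" "0 < vdot C A B"
    and sides: "dist B C < dist A C" "dist A C < dist A B"
begin

definition K where "K = \<bar>vcross A B C\<bar>"

lemma sides_pos: "0 < dist B C" "0 < dist A C" "0 < dist A B"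
  using noncollinear sides by (auto simp: insert_commute)

lemma side_squares:
  "(dist A B)\<^sup>2 = vdot A B C + vdot B A C" "(dist A C)\<^sup>2 = vdot A B C + vdot C A B"
  "(dist B C)\<^sup>2 = vdot B A C + vdot C A B"
  unfolding dist_sq by (simp_all add: inner_2 algebra_simps)

lemma side_squares_less: "(dist B C)\<^sup>2 < (dist A C)\<^sup>2" "(dist A C)\<^sup>2 < (dist A B)\<^sup>2"
  using sides by (auto intro!: power_strict_mono)

lemma vdots_less: "vdot C A B < vdot B A C" "vdot B A C < vdot A B C"
  using side_squares side_squares_less by linarith+

lemma K_pos: "0 < K"
  using noncollinear by (simp add: K_def collinear_iff_vcross)

lemma K_sq: "K\<^sup>2 = vdot A B C * vdot B A C + vdot B A C * vdot C A B + vdot C A B * vdot A B C"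
  unfolding K_def power2_abs lagrange side_squares by (simp add: power2_eq_square algebra_simps)

text \<open>The tangent of the angle at \<open>B\<close> is \<open>K / vdot B A C\<close>. So this
  angle exceeds pi/4, and by \<open>vdots_less\<close> so does the one at \<open>C\<close>.\<close>

lemma vdot_B_less_K: "vdot B A C < K"
proof (rule power2_less_imp_less)
  have "vdot B A C * vdot B A C < vdot A B C * vdot B A C"
    using vdots_less acute by simp
  moreover have "0 < vdot B A C * vdot C A B + vdot C A B * vdot A B C"
    using acute by (simp add: add_pos_pos)
  ultimately show "(vdot B A C)\<^sup>2 < K\<^sup>2" using K_sq unfolding power2_eq_square by linarith
qed (use K_pos in simp)

lemma vcross_perms: "\<bar>vcross A C B\<bar> = K" "\<bar>vcross B A C\<bar> = K" "\<bar>vcross B C A\<bar> = K"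
  "\<bar>vcross C A B\<bar> = K" "\<bar>vcross C B A\<bar> = K" "\<bar>vcross A B C\<bar> = K"
  by (auto simp: K_def scross_def abs_if algebra_simps)

end

section \<open>Area comparisons for a minimizer and the two implications\<close>

locale acute_scalene_min = acute_scalene +
  fixes T'
  assumes min: "min_area_isosceles_container (convex hull {A, B, C}) T'"
begin

lemma measure_le_first_kind:
  "measure lebesgue T' \<le> (dist A B / dist A C) * (K / 2)"
  "measure lebesgue T' \<le> (dist A C / dist B C) * (K / 2)"
proof -
  have "measure lebesgue T' \<le> (dist A B / dist A C) * (\<bar>vcross A B C\<bar> / 2)"
    using min noncollinear sides sides_pos by (intro min_area_le_stretch) (auto simp: dist_on_ray)
  then show "measure lebesgue T' \<le> (dist A B / dist A C) * (K / 2)" by (simp add: vcross_perms)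
  have "dist C (C + (dist A C / dist B C) *\<^sub>R (B - C)) = dist C A"
    using sides_pos by (subst dist_on_ray) (auto simp: dist_commute)
  then have "measure lebesgue T' \<le> (dist A C / dist B C) * (\<bar>vcross C A B\<bar> / 2)"
    using min noncollinear sides sides_pos
    by (intro min_area_le_stretch) (auto simp: insert_commute)
  then show "measure lebesgue T' \<le> (dist A C / dist B C) * (K / 2)" by (simp add: vcross_perms)
qed

text \<open>Comparison with \<open>AB1C\<close>: its base is twice the projection of AC to AB, so
  \<open>k\<close> is |AB1| / |AB|, and \<open>k \<ge> 1\<close> because the angle at
  \<open>A\<close> is smaller than that at \<open>B\<close>.\<close>

lemma measure_le_second_kind: "measure lebesgue T' * (dist A B)\<^sup>2 \<le> K * vdot A B C"
proof -
  define k where "k = 2 * vdot A B C / (dist A B)\<^sup>2"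
  have c: "0 < (dist A B)\<^sup>2" using sides_pos by simp
  have k: "k * (dist A B)\<^sup>2 = 2 * vdot A B C" using c by (simp add: k_def)
  have "(dist A B)\<^sup>2 \<le> 2 * vdot A B C" using side_squares(1) vdots_less by linarith
  then have k1: "1 \<le> k" using c by (simp add: k_def)
  then have "dist (A + k *\<^sub>R (B - A)) C = dist A C"
    using dist_stretch_eq_iff[of k A B C] k by simp
  then have "measure lebesgue T' \<le> k * (\<bar>vcross A C B\<bar> / 2)"
    using min noncollinear k1
    by (intro min_area_le_stretch) (auto simp: insert_commute dist_commute)
  then have "measure lebesgue T' * (dist A B)\<^sup>2 \<le> (k * (K / 2)) * (dist A B)\<^sup>2"
    using c by (simp add: vcross_perms)
  also have "\<dots> = K * vdot A B C" using k by simp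
  finally show ?thesis .
qed

lemma special_imp_obtuse:
  assumes "special_container_second_kind A B C T'"
  shows "obtuse_triangle T'"
proof -
  have b0: "0 < dist A C" "0 < dist B C" using sides_pos by auto
  consider (B1) D where "D \<in> ray A B" "D \<noteq> A" "dist D C = dist A C" "triangle_with_vertices A D C T'"
    | (C1) D where "D \<in> ray A C" "D \<noteq> A" "dist B D = dist A B" "triangle_with_vertices A B D T'"
    | (C2) D where "D \<in> ray B C" "D \<noteq> B" "dist A D = dist A B" "triangle_with_vertices A B D T'"
    using assms unfolding special_container_second_kind_def by blast
  then show ?thesis
  proof cases
    case B1
    then obtain t where t: "0 < t" "D = A + t *\<^sub>R (B - A)" "t * (dist A B)\<^sup>2 = 2 * vdot A B C"
      using ray_second_point by blast
    have "T' = convex hull {A, C, D}"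
      using B1 by (simp add: triangle_with_vertices_def insert_commute)
    then have "measure lebesgue T' = t * (K / 2)"
      using t by (simp add: measure_triangle stretch_vcross abs_mult vcross_perms)
    then have "t * (K / 2) \<le> (dist A C / dist B C) * (K / 2)" using measure_le_first_kind(2) by simp
    then have "t \<le> dist A C / dist B C" by (rule mult_right_le_imp_le) (use K_pos in simp)
    then have "t * dist B C \<le> dist A C" using b0 by (simp add: field_simps)
    then have "(t * dist B C)\<^sup>2 \<le> (dist A C)\<^sup>2" using t b0 by (intro power_mono) auto
    then have tt: "t\<^sup>2 * (dist B C)\<^sup>2 \<le> (dist A C)\<^sup>2" by (simp add: power_mult_distrib)
    \<comment> \<open>In the squared sides \<open>t * z = z + u\<close>, and
      \<open>t \<le> dist A C / dist B C\<close> becomes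
      \<open>x * (2 * z + u) \<le> z\<^sup>2\<close>. The scalar product at the apex
      \<open>C\<close>, multiplied by \<open>2 * z\<close>, is
      \<open>2 * (x * z) - z\<^sup>2 - u\<^sup>2\<close>, hence negative.\<close>
    define x u z where "x = (dist B C)\<^sup>2" and "u = (dist A C)\<^sup>2 - (dist B C)\<^sup>2" and "z = (dist A B)\<^sup>2"
    have pos: "0 < x" "0 < u" "0 < z" "(dist A C)\<^sup>2 = x + u" "2 * vdot A B C = z + u"
      unfolding x_def u_def z_def using acute side_squares_less side_squares by linarith+
    have tz: "t * z = z + u" using t(3) pos(5) unfolding z_def by simp
    have "(t\<^sup>2 * x) * z\<^sup>2 \<le> (x + u) * z\<^sup>2" using tt pos by (intro mult_right_mono) (auto simp: x_def)
    then have "x * (t * z)\<^sup>2 \<le> (x + u) * z\<^sup>2" by (simp add: power_mult_distrib mult_ac)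
    then have "u * (x * (2 * z + u)) \<le> u * z\<^sup>2"
      unfolding tz by (simp add: power2_eq_square algebra_simps)
    then have "x * (2 * z + u) \<le> z\<^sup>2" using pos by simp
    moreover have "0 < x * u" using pos by simp
    ultimately have xz: "2 * (x * z) < z\<^sup>2" by (simp add: algebra_simps)
    have vC: "vdot C A D = (dist A C)\<^sup>2 - t * vdot A B C"
      unfolding t(2) dist_sq by (simp add: inner_2 algebra_simps)
    have "(2 * z) * vdot C A D = 2 * z * (x + u) - (t * z) * (2 * vdot A B C)"
      unfolding vC pos(4) by (simp only: right_diff_distrib mult_ac)
    also have "\<dots> = 2 * (x * z) - z\<^sup>2 - u\<^sup>2"
      unfolding tz pos by (simp add: power2_eq_square algebra_simps)
    also have "\<dots> < 0" using xz zero_le_power2[of u] by linarith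
    finally have "vdot C A D < 0" using pos by (simp add: mult_less_0_iff)
    moreover note triangle_distinct[OF B1(4)]
    ultimately have "pi / 2 < angle A C D" by (subst angle_iff_vdot(2)) auto
    then show ?thesis using B1(4) unfolding obtuse_triangle_def by blast
  next
    case C1
    then have "dist D B = dist A B" by (simp add: dist_commute)
    then obtain t where t: "0 < t" "D = A + t *\<^sub>R (C - A)" "t * (dist A C)\<^sup>2 = 2 * vdot A C B"
      using ray_second_point[OF C1(1,2)] by blast
    have "T' = convex hull {A, B, D}"
      using C1 by (simp add: triangle_with_vertices_def)
    then have "measure lebesgue T' = t * (K / 2)"
      using t by (simp add: measure_triangle stretch_vcross abs_mult vcross_perms)
    then have "t * (K / 2) \<le> (dist A B / dist A C) * (K / 2)" using measure_le_first_kind(1) by simp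
    then have "t \<le> dist A B / dist A C" by (rule mult_right_le_imp_le) (use K_pos in simp)
    \<comment> \<open>The bound on \<open>t\<close> would make the angle at \<open>A\<close> at
      least as large as that at \<open>B\<close>, so this case cannot occur.\<close>
    then have "t * (dist A C)\<^sup>2 \<le> (dist A B / dist A C) * (dist A C)\<^sup>2" by (intro mult_right_mono) auto
    also have "\<dots> = dist A B * dist A C" using b0 by (simp add: power2_eq_square)
    also have "\<dots> \<le> (dist A B)\<^sup>2" unfolding power2_eq_square using sides by (intro mult_left_mono) auto
    finally have "2 * vdot A C B \<le> (dist A B)\<^sup>2" using t by simp
    then have "vdot A B C \<le> vdot B A C" using side_squares(1) by (simp add: inner_commute)
    then show ?thesis using vdots_less by simp
  next
    case C2
    then have "dist D A = dist B A" by (simp add: dist_commute)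
    then obtain t where t: "0 < t" "D = B + t *\<^sub>R (C - B)" "t * (dist B C)\<^sup>2 = 2 * vdot B C A"
      using ray_second_point[OF C2(1,2)] by blast
    have "T' = convex hull {B, A, D}"
      using C2 by (simp add: triangle_with_vertices_def insert_commute)
    then have "measure lebesgue T' = t * (K / 2)"
      using t by (simp add: measure_triangle stretch_vcross abs_mult vcross_perms)
    then have "t * (K / 2) \<le> (dist A B / dist A C) * (K / 2)" using measure_le_first_kind(1) by simp
    then have "t \<le> dist A B / dist A C" by (rule mult_right_le_imp_le) (use K_pos in simp)
    then have "t * dist A C \<le> dist A B" using b0 by (simp add: field_simps)
    then have "(t * dist A C) * (dist B C)\<^sup>2 \<le> dist A B * (dist B C)\<^sup>2" by (intro mult_right_mono) auto
    moreover have "t * (dist B C)\<^sup>2 = (dist B C)\<^sup>2 + ((dist A B)\<^sup>2 - (dist A C)\<^sup>2)"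
      using t(3) side_squares by (simp add: inner_commute)
    ultimately have "((dist B C)\<^sup>2 + ((dist A B)\<^sup>2 - (dist A C)\<^sup>2)) * dist A C \<le> dist A B * (dist B C)\<^sup>2"
      by (metis mult.assoc mult.commute)
    \<comment> \<open>Cancelling the positive factor bounds a quantity above
      \<open>(dist A C)\<^sup>2\<close> by \<open>(dist B C)\<^sup>2\<close>, which is
      absurd.\<close>
    then have "(dist A B - dist A C) * ((dist A B + dist A C) * dist A C)
        \<le> (dist A B - dist A C) * (dist B C)\<^sup>2"
      by (simp add: power2_eq_square algebra_simps)
    then have "(dist A B + dist A C) * dist A C \<le> (dist B C)\<^sup>2" using sides by simp
    moreover have "(dist A C)\<^sup>2 \<le> (dist A B + dist A C) * dist A C" by (simp add: power2_eq_square algebra_simps)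
    ultimately show ?thesis using side_squares_less by linarith
  qed
qed

lemma obtuse_imp_special:
  assumes "obtuse_triangle T'"
  shows "special_container_second_kind A B C T'"
proof -
  have iso: "isosceles_triangle T'" and sub: "convex hull {A, B, C} \<subseteq> T'"
    using min by (auto simp: min_area_isosceles_container_def isosceles_container_def)
  obtain P Q R where PQR: "triangle_with_vertices P Q R T'" "dist P Q = dist P R" "vdot P Q R < 0"
    using obtuse_isosceles_apex[OF iso assms] .
  obtain M e1 e2 h L where on: "e1 \<bullet> e1 = 1" "e2 \<bullet> e2 = 1" "e1 \<bullet> e2 = 0" and h: "0 < h" "h < L"
    and P: "P = M + h *\<^sub>R e2" and Q: "Q = M - L *\<^sub>R e1" and R: "R = M + L *\<^sub>R e1"
    by (rule obtuse_isosceles_frame[OF PQR])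
  interpret frame M e1 e2 using on by unfold_locales
  have pts: "P = pt 0 h" "Q = pt (- L) 0" "R = pt L 0" by (simp_all add: P Q R pt_def)
  have T': "T' = convex hull {pt 0 h, pt (- L) 0, pt L 0}"
    using PQR(1) by (simp add: triangle_with_vertices_def pts)
  have area: "measure lebesgue T' = h * L"
    unfolding T' measure_triangle_coords using h by (simp add: scross_def)
  have fit: "\<forall>Z\<in>{A, B, C}. fits xc yc h L Z"
    using sub h unfolding T' by (auto intro!: fits_in_triangle simp: hull_inc)
  have cr: "\<bar>scross xc yc A B C\<bar> = K" "\<bar>scross xc yc B A C\<bar> = K" "\<bar>scross xc yc C A B\<bar> = K"
    by (simp_all add: scross_coords vcross_perms)
  have S: "h * L * (dist A B)\<^sup>2 \<le> K * vdot A B C" using measure_le_second_kind area by simp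
  moreover have "h * L * (dist A C)\<^sup>2 \<le> h * L * (dist A B)\<^sup>2"
    using h sides by (intro mult_left_mono) auto
  ultimately have "corner_bound xc yc h L A B C"
    unfolding corner_bound_def cr sdot_coords dist_coords[symmetric] by auto
  \<comment> \<open>The angles at \<open>B\<close> and \<open>C\<close> exceed pi/4, so these bounds
    hold vacuously.\<close>
  moreover have "corner_bound xc yc h L B A C" "corner_bound xc yc h L C A B"
    unfolding corner_bound_def cr sdot_coords using vdot_B_less_K vdots_less by auto
  moreover have "scross xc yc A B C \<noteq> 0" using cr(1) K_pos by auto
  moreover have "right_bound xc yc h L {A, B, C}"
    using right_bound_of_min[OF min area] noncollinear by simp
  ultimately have tight: "tight xc yc h L A B C"
    unfolding tight_def sdot_coords using h fit acute by simp
  \<comment> \<open>By \<open>extremal_corner\<close> a vertex in the base corner has an angle below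
    pi/4; this rules out \<open>B\<close> and \<open>C\<close>.\<close>
  have no: "\<not> extremal xc yc h L V U W"
    if "V \<in> {B, C}" "U \<in> {A, B, C}" "\<bar>scross xc yc V U W\<bar> = K" "vdot V U W \<le> vdot B A C"
      "0 < vdot V U W" for V U W
    using extremal_corner(3)[of xc yc h L V U W] that fit h vdot_B_less_K unfolding sdot_coords
    by fastforce
  \<comment> \<open>This would be the position \<open>ABC1\<close>, where
    \<open>h * L * (dist A C)\<^sup>2\<close> equals \<open>K * vdot A B C\<close>; as AC is shorter
    than AB, \<open>S\<close> fails.\<close>
  have "\<not> extremal xc yc h L A C B"
  proof
    assume e: "extremal xc yc h L A C B"
    note c = extremal_corner[OF e _ h]
    have *: "K = \<bar>xc C - xc A\<bar> * h" "vdot A B C = \<bar>xc C - xc A\<bar> * L"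
      using c fit acute unfolding sdot_coords by (simp_all add: scross_coords vcross_perms inner_commute)
    have "(dist A C)\<^sup>2 = \<bar>xc C - xc A\<bar> * \<bar>xc C - xc A\<bar>"
      using e unfolding dist_coords by (simp add: extremal_def power2_eq_square)
    then have "K * vdot A B C = h * L * (dist A C)\<^sup>2" unfolding * by (simp add: mult_ac)
    with S have "h * L * (dist A B)\<^sup>2 \<le> h * L * (dist A C)\<^sup>2" by simp
    then show False using h sides by simp
  qed
  moreover have "extremal_some xc yc h L A B C" using tight_extremal_some[OF tight] .
  ultimately have e: "extremal xc yc h L A B C"
    using no[of B A C] no[of B C A] no[of C A B] no[of C B A] acute vdots_less
    unfolding extremal_some_def by (auto simp: scross_coords vcross_perms inner_commute)
  then have C: "C = pt 0 h" by (intro pt_eqI) (auto simp: extremal_def)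
  \<comment> \<open>The other base corner, the mirror image of \<open>A\<close> in the axis, serves
    as \<open>B1\<close>.\<close>
  define D where "D = pt (- xc A) 0"
  have A: "A = pt (xc A) 0" by (intro pt_eqI) (use e in \<open>auto simp: extremal_def\<close>)
  have B: "B = pt (xc B) 0" by (intro pt_eqI) (use e in \<open>auto simp: extremal_def\<close>)
  have xA: "xc A = L \<or> xc A = - L" using e by (auto simp: extremal_def)
  have "sdot xc yc A B C = (xc B - xc A) * (- xc A)" using e by (simp add: extremal_def sdot_def)
  then have pos: "0 < (xc B - xc A) * (- xc A)" using acute by (simp add: sdot_coords)
  \<comment> \<open>The parameter at which the line AB reaches \<open>D\<close>. The acute angle at
    \<open>A\<close> puts \<open>B\<close> on the inner side of the corner, whence
    \<open>0 \<le> t\<close>.\<close>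
  define t where "t = - 2 * xc A / (xc B - xc A)"
  have t: "0 \<le> t" "t * (xc B - xc A) = - 2 * xc A"
    using pos by (auto simp: t_def mult_less_0_iff divide_le_0_iff)
  have "A + t *\<^sub>R (B - A) = pt (xc A) 0 + t *\<^sub>R (pt (xc B) 0 - pt (xc A) 0)"
    using A B by simp
  also have "\<dots> = pt (xc A + t * (xc B - xc A)) 0"
    by (simp add: pt_def algebra_simps)
  also have "\<dots> = D" by (simp add: t D_def)
  finally have "D \<in> ray A B" unfolding ray_def using t by force
  moreover have "D \<noteq> A"
  proof
    assume "D = A"
    then have "xc D = xc A" by simp
    then show False using xA h by (auto simp: D_def)
  qed
  moreover have "(dist D C)\<^sup>2 = (dist A C)\<^sup>2"
    using e unfolding dist_coords by (simp add: extremal_def D_def)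
  then have "dist D C = dist A C" by simp
  moreover have "{A, D, C} = {P, Q, R}"
    using xA A C unfolding D_def pts by auto
  then have "triangle_with_vertices A D C T'"
    using PQR(1) by (simp add: triangle_with_vertices_def)
  ultimately show ?thesis unfolding special_container_second_kind_def by blast
qed

end

theorem corollary1p5:
  fixes A B C :: point and a b c :: real and T T' :: "point set"
  assumes "triangle_with_vertices A B C T"
    and "acute_triangle T"
    and "a = dist B C" and "b = dist A C" and "c = dist A B"
    and "a < b" and "b < c"
    and "min_area_isosceles_container T T'"
  shows "obtuse_triangle T' \<longleftrightarrow> special_container_second_kind A B C T'"
proof -
  interpret acute_scalene_min A B C T'
    using assms acute_triangle_vdot[OF assms(1,2)]
    by unfold_locales (auto simp: triangle_with_vertices_def)
  show ?thesis using obtuse_imp_special special_imp_obtuse by blast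
qed

end
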